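(* For every integer $n \geq 0$ and every fixed $t > 0$ there exists a constant $c_{n,t} > 0$, depending only on $n$ and $t$, such that for every continuous function $f:\mathbb{T}\rightarrow\mathbb{R}$, not identically zero, that changes sign $n$ times, $$\|\theta_t * f\|_{L^\infty(\mathbb{T})} \geq c_{n,t} \frac{\|f\|_{L^1(\mathbb{T})}^{n+1}}{\|f\|_{L^\infty(\mathbb{T})}^{n}}.$$
   Context: $\mathbb{T} = \mathbb{R}/2\pi\mathbb{Z}$ is the circle of length $2\pi$. For $t>0$, $\theta_t$ is the heat kernel on $\mathbb{T}$ (Jacobi theta function) $$\theta_t(x) = \frac{1}{2\pi} + \frac{1}{\pi}\sum_{m=1}^\infty e^{-m^2 t}\cos(mx),$$ and $(\theta_t * f)(x) = \int_0^{2\pi}\theta_t(x-y) f(y)\,dy$, so that $\theta_t * f$ is the solution at time $t$ of the heat equation on $\mathbb{T}$ with initial datum $f$. The number of sign changes of a continuous $f:\mathbb{T}\to\mathbb{R}$ is the largest $n$ for which there are points $x_1, \dots, x_n$ in cyclic order on $\mathbb{T}$ such that $f$ takes nonzero values of opposite sign at any two cyclically consecutive points (including the pair $x_n, x_1$), and it is $0$ if no such points exist; when finite, this number is even. *)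

theory Defs
  imports "HOL-Analysis.Analysis" "HOL-Probability.Essential_Supremum"
begin

(* Functions on the circle R/2piZ are represented by 2pi-periodic functions on the reals;
   integration over the circle is Lebesgue integration over the fundamental domain [0, 2pi). *)
definition circle_measure :: "real measure" where
  "circle_measure = restrict_space lborel {0..<2 * pi}"

definition circle_continuous :: "(real \<Rightarrow> real) \<Rightarrow> bool" where
  "circle_continuous f \<longleftrightarrow> continuous_on UNIV f \<and> (\<forall>x. f (x + 2 * pi) = f x)"

definition L1_norm :: "(real \<Rightarrow> real) \<Rightarrow> real" where
  "L1_norm f = (\<integral>x. \<bar>f x\<bar> \<partial>circle_measure)"

(* The essential supremum is taken in ereal and is finite for bounded measurable functions;
   real_of_ereal sends infinite values to 0. *)
definition Linf_norm :: "(real \<Rightarrow> real) \<Rightarrow> real" where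
  "Linf_norm f = real_of_ereal (esssup circle_measure (\<lambda>x. ereal \<bar>f x\<bar>))"

definition heat_kernel :: "real \<Rightarrow> real \<Rightarrow> real" where
  "heat_kernel t x = 1 / (2 * pi) +
     1 / pi * (\<Sum>k. exp (- ((real (Suc k))\<^sup>2 * t)) * cos (real (Suc k) * x))"

definition heat_flow :: "real \<Rightarrow> (real \<Rightarrow> real) \<Rightarrow> real \<Rightarrow> real" where
  "heat_flow t f x = (\<integral>y. heat_kernel t (x - y) * f y \<partial>circle_measure)"

(* Points x 0, ..., x (n - 1) of the circle in cyclic order are given by real lifts that increase
   within less than one period.  For n = 0 the condition is vacuous, and n = 1 is impossible. *)
definition cyclic_alternation :: "(real \<Rightarrow> real) \<Rightarrow> nat \<Rightarrow> bool" where
  "cyclic_alternation f n \<longleftrightarrow>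
     (\<exists>x :: nat \<Rightarrow> real.
        (\<forall>i j. i < j \<and> j < n \<longrightarrow> x i < x j \<and> x j < x i + 2 * pi) \<and>
        (\<forall>i<n. f (x i) * f (x (Suc i mod n)) < 0))"

(* The maximum exists exactly when the number of sign changes is finite. *)
definition changes_sign_times :: "(real \<Rightarrow> real) \<Rightarrow> nat \<Rightarrow> bool" where
  "changes_sign_times f n \<longleftrightarrow>
     cyclic_alternation f n \<and> (\<forall>m. cyclic_alternation f m \<longrightarrow> m \<le> n)"

end

theory Submission
  imports Defs
begin

text \<open>If \<open>f\<close> changes sign \<open>n\<close> times, there are an even number \<open>2k \<le> n\<close> of points \<open>z\<close> such that
  \<open>p x = (\<Prod>z. sin ((z - x) / 2))\<close> has, up to a global sign, the same sign as \<open>f\<close>, so that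
  \<open>\<integral> f p = \<plusminus> \<integral> \<bar>f\<bar> \<bar>p\<bar>\<close>.  This \<open>p\<close> is a trigonometric polynomial of degree \<open>k\<close>, and the heat flow
  multiplies frequency \<open>j\<close> by \<open>exp (- j\<^sup>2 t)\<close>, hence \<open>\<integral> f p\<close> is at most a constant times the sup norm of
  the heat flow.  Conversely \<open>\<bar>p\<bar> \<ge> (\<delta> / \<pi>)\<^sup>n\<close> off a set of measure \<open>O(n \<delta>)\<close>; choosing \<open>\<delta>\<close> a small
  multiple of \<open>\<parallel>f\<parallel>\<^sub>1 / \<parallel>f\<parallel>\<^sub>\<infinity>\<close>, that set carries at most half of \<open>\<parallel>f\<parallel>\<^sub>1\<close>, which bounds
  \<open>\<integral> \<bar>f\<bar> \<bar>p\<bar>\<close> from below.\<close>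

section \<open>Sign changes and products of half-angle sines\<close>

text \<open>Greedy choice of zeros. The first zero is the infimum \<open>z\<close> of the points
  where \<open>s * g\<close> is negative; to its right the search restarts with \<open>- s\<close>
  and one alternation fewer. Since \<open>{a..b}\<close> has length at most \<open>2 * pi\<close>,
  each factor \<open>sin ((z - x) / 2)\<close> changes sign there only at \<open>z\<close>. The
  indices \<open>0..m\<close> stand for \<open>m + 1\<close> points, which is why \<open>m\<close>
  zeros suffice.\<close>

lemma sign_pattern:
  fixes g :: "real \<Rightarrow> real"
  assumes g: "continuous_on UNIV g" and ab: "b \<le> a + 2 * pi"
    and no_alt: "\<nexists>x::nat \<Rightarrow> real. (\<forall>i j. i < j \<and> j \<le> m \<longrightarrow> x i < x j) \<and>
      (\<forall>i\<le>m. x i \<in> {a..b} \<and> s * (-1) ^ i * g (x i) < 0)"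
  shows "\<exists>zs. length zs \<le> m \<and> set zs \<subseteq> {a..b} \<and>
    (\<forall>x\<in>{a..b}. s * g x * (\<Prod>z\<leftarrow>zs. sin ((z - x) / 2)) \<ge> 0)"
  using ab no_alt
proof (induction m arbitrary: a s)
  case 0
  have "s * g y \<ge> 0" if "y \<in> {a..b}" for y
    using 0(2)[unfolded not_ex, rule_format, of "\<lambda>_. y"] that by auto
  then show ?case by (intro exI[of _ "[]"]) auto
next
  case (Suc m)
  define S where "S = {y \<in> {a..b}. s * g y < 0}"
  show ?case
  proof (cases "S = {}")
    case True
    then have "\<forall>y\<in>{a..b}. s * g y \<ge> 0" by (force simp: S_def)
    then show ?thesis by (intro exI[of _ "[]"]) auto
  next
    case False
    define z where "z = Inf S"
    have bdd: "bdd_below S" by (auto simp: S_def intro!: bdd_belowI[of _ a])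
    have zb: "z \<in> {a..b}"
    proof -
      obtain y where y: "y \<in> S" using False by blast
      have "z \<le> y" unfolding z_def by (rule cInf_lower[OF y bdd])
      moreover have "a \<le> z" unfolding z_def using False by (intro cInf_greatest) (auto simp: S_def)
      ultimately show ?thesis using y by (auto simp: S_def)
    qed
    have "closed {y. s * g y \<le> 0}"
      using continuous_on_mult_left[OF g] by (intro closed_Collect_le) auto
    then have "closure S \<subseteq> {y. s * g y \<le> 0}"
      by (intro closure_minimal) (auto simp: S_def)
    moreover have "z \<in> closure S" unfolding z_def by (rule closure_contains_Inf[OF False bdd])
    ultimately have gz: "s * g z \<le> 0" by auto
    have "\<nexists>x::nat \<Rightarrow> real. (\<forall>i j. i < j \<and> j \<le> m \<longrightarrow> x i < x j) \<and>
      (\<forall>i\<le>m. x i \<in> {z..b} \<and> (-s) * (-1) ^ i * g (x i) < 0)"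
    proof
      assume "\<exists>x::nat \<Rightarrow> real. (\<forall>i j. i < j \<and> j \<le> m \<longrightarrow> x i < x j) \<and>
      (\<forall>i\<le>m. x i \<in> {z..b} \<and> (-s) * (-1) ^ i * g (x i) < 0)"
      then obtain x :: "nat \<Rightarrow> real" where x: "\<And>i j. i < j \<Longrightarrow> j \<le> m \<Longrightarrow> x i < x j"
        "\<And>i. i \<le> m \<Longrightarrow> x i \<in> {z..b}" "\<And>i. i \<le> m \<Longrightarrow> (-s) * (-1) ^ i * g (x i) < 0"
        by blast
      \<comment> \<open>Here \<open>s * g (x 0) > 0\<close> whereas \<open>s * g z \<le> 0\<close>
        by continuity, so \<open>x 0\<close> lies strictly beyond the infimum and some
        \<open>y\<close> in \<open>S\<close> precedes it. Prepending \<open>y\<close> gives the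
        forbidden longer alternation.\<close>
      have "x 0 \<noteq> z" using x(3)[of 0] gz by auto
      then have "Inf S < x 0" using x(2)[of 0] by (auto simp: z_def)
      then obtain y where y: "y \<in> S" "y < x 0" using cInf_less_iff[OF False bdd] by blast
      define x' where "x' = case_nat y x"
      have "x' i < x' j" if "i < j" "j \<le> Suc m" for i j
        using that x(1)[of "i - 1" "j - 1"] x(1)[of 0 "j - 1"] y(2)
        by (cases i; cases j; cases "j = 1") (auto simp: x'_def)
      moreover have "x' i \<in> {a..b} \<and> s * (-1) ^ i * g (x' i) < 0" if "i \<le> Suc m" for i
        using that y(1) x(2,3)[of "i - 1"] zb by (cases i) (auto simp: x'_def S_def)
      ultimately show False using Suc.prems(2) by blast
    qed
    moreover have "b \<le> z + 2 * pi" using zb Suc.prems(1) by auto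
    ultimately obtain zs where zs: "length zs \<le> m" "set zs \<subseteq> {z..b}"
      "\<forall>x\<in>{z..b}. (-s) * g x * (\<Prod>z\<leftarrow>zs. sin ((z - x) / 2)) \<ge> 0"
      using Suc.IH[of z "-s"] by blast
    have "s * g x * (\<Prod>z\<leftarrow>z # zs. sin ((z - x) / 2)) \<ge> 0" if x: "x \<in> {a..b}" for x
    proof (cases "z \<le> x")
      case True
      \<comment> \<open>To the right of \<open>z\<close> the new factor is nonpositive, which
        compensates for the passage from \<open>s\<close> to \<open>- s\<close>.\<close>
      then have "sin ((x - z) / 2) \<ge> 0"
        using x zb Suc.prems(1) by (intro sin_ge_zero) auto
      moreover have "sin ((z - x) / 2) = - sin ((x - z) / 2)"
        by (metis minus_diff_eq minus_divide_left sin_minus)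
      moreover have "(-s) * g x * (\<Prod>z\<leftarrow>zs. sin ((z - x) / 2)) \<ge> 0"
        using zs(3) True x by auto
      ultimately have "sin ((x - z) / 2) * ((-s) * g x * (\<Prod>z\<leftarrow>zs. sin ((z - x) / 2))) \<ge> 0"
        by (metis mult_nonneg_nonneg)
      then show ?thesis using \<open>sin ((z - x) / 2) = _\<close> by (simp add: algebra_simps)
    next
      case False
      then have "x \<notin> S" using cInf_lower[OF _ bdd] by (auto simp: z_def)
      then have "s * g x \<ge> 0" using x by (auto simp: S_def)
      \<comment> \<open>To the left of \<open>z\<close> every zero is still ahead of
        \<open>x\<close>, by at most \<open>2 * pi\<close>, so no factor is negative.\<close>
      moreover have "(\<Prod>z\<leftarrow>z # zs. sin ((z - x) / 2)) \<ge> 0"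
        using False x zb zs(2) Suc.prems(1)
        by (intro prod_list_nonneg) (auto intro!: sin_ge_zero)
      ultimately show ?thesis by (rule mult_nonneg_nonneg)
    qed
    then show ?thesis using zs zb by (intro exI[of _ "z # zs"]) auto
  qed
qed

lemma cyclic_alternation_sign:
  assumes "\<forall>i<n. f (x i) * f (x (Suc i mod n)) < (0::real)" "i < n"
  shows "(-1) ^ i * f (x i) * f (x 0) > 0"
  using assms(2)
proof (induction i)
  case 0
  then have "f (x 0) \<noteq> 0" using assms(1) by fastforce
  then show ?case by (auto simp: zero_less_mult_iff)
next
  case (Suc i)
  have "f (x i) * f (x (Suc i)) < 0" using assms(1) Suc.prems by (metis Suc_lessD mod_less)
  then show ?case using Suc
    by (cases "even i") (auto simp: zero_less_mult_iff mult_less_0_iff)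
qed

text \<open>One turn around the circle flips the sign \<open>n\<close> times and returns to the
  starting point. For odd \<open>n\<close> the last point would have the sign of \<open>x 0\<close>,
  against the wrap-around condition.\<close>

lemma cyclic_alternation_even:
  assumes "cyclic_alternation f n"
  shows "even n"
proof (rule ccontr)
  assume odd: "odd n"
  obtain x where x: "\<forall>i<n. f (x i) * f (x (Suc i mod n)) < 0"
    using assms by (auto simp: cyclic_alternation_def)
  have "n > 0" using odd by (cases n) auto
  then have "(-1) ^ (n - 1) * f (x (n - 1)) * f (x 0) > 0"
    using x by (intro cyclic_alternation_sign[where n = n]) auto
  moreover have "f (x (n - 1)) * f (x 0) < 0"
    using x \<open>n > 0\<close> by (metis Suc_pred' diff_less less_numeral_extra(1) mod_self)
  ultimately show False using odd by auto
qed

text \<open>Evenness of \<open>n\<close> is what gives the wrap-around pair opposite signs, so that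
  a linear alternation closes up to a cyclic one.\<close>

lemma cyclic_alternation_even_points:
  assumes "even n" "\<And>i j. i < j \<Longrightarrow> j < n \<Longrightarrow> x i < x j \<and> x j < x i + 2 * pi"
    and "\<And>i. i < n \<Longrightarrow> s * (-1) ^ i * f (x i) > 0"
  shows "cyclic_alternation f n"
  unfolding cyclic_alternation_def
proof (intro exI[of _ x] conjI allI impI)
  fix i assume i: "i < n"
  show "f (x i) * f (x (Suc i mod n)) < 0"
  proof (cases "Suc i = n")
    case True
    then have "odd i" using assms(1) by auto
    then show ?thesis using True assms(3)[OF i] assms(3)[of 0] i
      by (auto simp: zero_less_mult_iff mult_less_0_iff)
  next
    case False
    then have "Suc i < n" using i by simp
    then show ?thesis using assms(3)[OF i] assms(3)[of "Suc i"]
      by (cases "even i") (auto simp: zero_less_mult_iff mult_less_0_iff)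
  qed
qed (use assms in auto)

lemma periodic_reduce:
  fixes h :: "real \<Rightarrow> 'a"
  assumes "\<And>x. h (x + 2 * pi) = h x"
  obtains y where "y \<in> {a..<a + 2 * pi}" "h y = h x"
proof -
  interpret periodic_fun_simple h "2 * pi" by unfold_locales (rule assms)
  define k where "k = \<lfloor>(x - a) / (2 * pi)\<rfloor>"
  have "of_int k \<le> (x - a) / (2 * pi)" "(x - a) / (2 * pi) < of_int k + 1"
    by (auto simp: k_def)
  then have "x - of_int k * (2 * pi) \<in> {a..<a + 2 * pi}"
    by (simp add: field_simps)
  then show ?thesis using that minus_of_int[of x k] by blast
qed

text \<open>The factors have half-integer frequency: for a list of even length this is a
  trigonometric polynomial of degree half that length, with zeros exactly at the listed points
  modulo \<open>2 * pi\<close>.\<close>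

definition sin_prod :: "real list \<Rightarrow> real \<Rightarrow> real" where
  "sin_prod zs x = (\<Prod>z\<leftarrow>zs. sin ((z - x) / 2))"

lemma sin_prod_shift: "sin_prod zs (x + 2 * pi) = (-1) ^ length zs * sin_prod zs x"
proof (induction zs)
  case (Cons z zs)
  have "(z - (x + 2 * pi)) / 2 = (z - x) / 2 - pi" by (simp add: field_simps)
  then have "sin ((z - (x + 2 * pi)) / 2) = - sin ((z - x) / 2)"
    by (simp only: sin_diff) simp
  then show ?case using Cons by (simp add: sin_prod_def)
qed (simp add: sin_prod_def)

text \<open>The circle is cut open at a point \<open>a\<close> with \<open>f a \<noteq> 0\<close>.
  An alternation of \<open>n + 1\<close> points starting with the sign opposite to
  \<open>f a\<close> would, together with \<open>a\<close>, give \<open>n + 2\<close> cyclic sign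
  changes; hence \<open>sign_pattern\<close> applies with \<open>m = n\<close>.\<close>

lemma sign_changes_sin_prod:
  assumes f: "circle_continuous f" "\<exists>x. f x \<noteq> 0" and n: "changes_sign_times f n"
  obtains s zs where "\<bar>s\<bar> = 1" "even (length zs)" "length zs \<le> n" "\<And>x. s * f x * sin_prod zs x \<ge> 0"
proof -
  have cont: "continuous_on UNIV f" and per: "\<And>x. f (x + 2 * pi) = f x"
    using f(1) by (auto simp: circle_continuous_def)
  obtain a where a: "f a \<noteq> 0" using f(2) by blast
  define s where "s = sgn (f a)"
  have s: "\<bar>s\<bar> = 1" "s * f a > 0" using a by (auto simp: s_def sgn_if)
  define b where "b = a + 2 * pi"
  have fb: "s * f b > 0" using s per by (simp add: b_def)
  have even: "even n" using n by (auto simp: changes_sign_times_def intro: cyclic_alternation_even)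
  have "\<nexists>x::nat \<Rightarrow> real. (\<forall>i j. i < j \<and> j \<le> n \<longrightarrow> x i < x j) \<and>
      (\<forall>i\<le>n. x i \<in> {a..b} \<and> s * (-1) ^ i * f (x i) < 0)"
  proof
    assume "\<exists>x::nat \<Rightarrow> real. (\<forall>i j. i < j \<and> j \<le> n \<longrightarrow> x i < x j) \<and>
      (\<forall>i\<le>n. x i \<in> {a..b} \<and> s * (-1) ^ i * f (x i) < 0)"
    then obtain x :: "nat \<Rightarrow> real" where x: "\<And>i j. i < j \<Longrightarrow> j \<le> n \<Longrightarrow> x i < x j"
        "\<And>i. i \<le> n \<Longrightarrow> x i \<in> {a..b}" "\<And>i. i \<le> n \<Longrightarrow> s * (-1) ^ i * f (x i) < 0"
      by blast
    \<comment> \<open>At both ends \<open>f\<close> has sign \<open>s\<close>, but at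
      \<open>x 0\<close> and, \<open>n\<close> being even, at \<open>x n\<close> it has sign
      \<open>- s\<close>. So the points avoid the ends, as the strict cyclic order requires.\<close>
    have x0: "a < x 0" using x(3)[of 0] x(2)[of 0] s by (cases "x 0 = a") auto
    have xn: "x n < b" using x(3)[of n] x(2)[of n] fb even by (cases "x n = b") auto
    have lo: "a < x i" if "i \<le> n" for i using x(1)[of 0 i] x0 that by (cases "i = 0") auto
    have hi: "x i < b" if "i \<le> n" for i using x(1)[of i n] xn that by (cases "i = n") auto
    define x' where "x' = case_nat a x"
    have "cyclic_alternation f (n + 2)"
    proof (rule cyclic_alternation_even_points[where x = x' and s = s])
      fix i j :: nat assume ij: "i < j" "j < n + 2"
      show "x' i < x' j \<and> x' j < x' i + 2 * pi"
        using ij x(1)[of "i - 1" "j - 1"] lo[of "j - 1"] hi[of "j - 1"] lo[of "i - 1"]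
        by (cases i; cases j) (auto simp: x'_def b_def)
    next
      fix i assume "i < n + 2"
      then show "s * (-1) ^ i * f (x' i) > 0" using s x(3)[of "i - 1"]
        by (cases i) (auto simp: x'_def)
    qed (use even in auto)
    then show False using n by (force simp: changes_sign_times_def)
  qed
  from sign_pattern[OF cont _ this] obtain zs where zs: "length zs \<le> n" 
    "\<And>x. x \<in> {a..b} \<Longrightarrow> s * f x * sin_prod zs x \<ge> 0"
    by (auto simp: b_def sin_prod_def)
  obtain ws where ws: "length ws \<le> n" "even (length ws)"
    "\<And>x. x \<in> {a..b} \<Longrightarrow> s * f x * sin_prod ws x \<ge> 0"
  proof (cases "even (length zs)")
    case False
    \<comment> \<open>The factor \<open>sin ((b - x) / 2)\<close> is nonnegative on \<open>{a..b}\<close>, so it repairs the parity for free.\<close>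
    have "s * f x * sin_prod (b # zs) x \<ge> 0" if "x \<in> {a..b}" for x
    proof -
      have "sin ((b - x) / 2) \<ge> 0" using that by (intro sin_ge_zero) (auto simp: b_def)
      then have "sin ((b - x) / 2) * (s * f x * sin_prod zs x) \<ge> 0"
        using zs(2)[OF that] by (rule mult_nonneg_nonneg)
      then show ?thesis by (simp add: sin_prod_def mult_ac)
    qed
    \<comment> \<open>An odd length bounded by the even number \<open>n\<close> is strictly smaller,
      which leaves room for one more zero.\<close>
    moreover have "length (b # zs) \<le> n" 
      using zs(1) False even by (cases "length zs = n") auto
    ultimately show ?thesis using that[of "b # zs"] False by simp
  qed (use that zs in blast)
  \<comment> \<open>With an even number of factors the product is \<open>2 * pi\<close>-periodic, so
    the sign condition spreads from one period to the whole line.\<close>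
  have "s * f x * sin_prod ws x \<ge> 0" for x
  proof -
    have "s * f (x + 2 * pi) * sin_prod ws (x + 2 * pi) = s * f x * sin_prod ws x" for x
      using ws(2) by (simp add: per sin_prod_shift)
    from periodic_reduce[of "\<lambda>x. s * f x * sin_prod ws x", OF this, of a x]
    show ?thesis using ws(3) by (metis atLeastAtMost_iff atLeastLessThan_iff b_def less_imp_le)
  qed
  then show ?thesis using that s ws by blast
qed

section \<open>Integration over one period\<close>

lemma space_circle_measure [simp]: "space circle_measure = {0..<2 * pi}"
  by (simp add: circle_measure_def space_restrict_space)

lemma borel_measurable_circle:
  "h \<in> borel_measurable borel \<Longrightarrow> h \<in> borel_measurable circle_measure"
  unfolding circle_measure_def by (rule measurable_restrict_space1) simp

lemma emeasure_circle_measure_space: "emeasure circle_measure {0..<2 * pi} = ennreal (2 * pi)"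
  by (simp add: circle_measure_def emeasure_restrict_space)

interpretation circle: finite_measure circle_measure
  by standard (simp add: emeasure_circle_measure_space)

lemma measure_circle_le:
  assumes "A \<in> sets borel" "A \<subseteq> B" "B \<in> fmeasurable lborel" "A \<subseteq> {0..<2 * pi}"
  shows "measure circle_measure A \<le> measure lborel B"
proof -
  have "measure circle_measure A = measure lborel A"
    unfolding circle_measure_def using assms(4) by (intro measure_restrict_space) auto
  also have "\<dots> \<le> measure lborel B"
    using assms(1) by (intro measure_mono_fmeasurable assms(2,3)) simp
  finally show ?thesis .
qed

lemma continuous_bounded_period:
  fixes h :: "real \<Rightarrow> real"
  assumes "continuous_on UNIV h"
  obtains B where "\<forall>x\<in>{0..2 * pi}. \<bar>h x\<bar> \<le> B"
proof -
  have "compact (h ` {0..2 * pi})"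
    by (intro compact_continuous_image continuous_on_subset[OF assms]) auto
  then show ?thesis using that by (auto dest!: compact_imp_bounded simp: bounded_iff)
qed

lemma integrable_circle_continuous:
  fixes h :: "real \<Rightarrow> real"
  assumes "continuous_on UNIV h"
  shows "integrable circle_measure h"
proof -
  obtain B where B: "\<forall>x\<in>{0..2 * pi}. \<bar>h x\<bar> \<le> B"
    by (rule continuous_bounded_period[OF assms])
  show ?thesis
  proof (rule circle.integrable_const_bound)
    show "AE x in circle_measure. norm (h x) \<le> B" by (rule AE_I2) (use B in simp)
    show "h \<in> borel_measurable circle_measure"
      by (rule borel_measurable_circle[OF borel_measurable_continuous_onI[OF assms]])
  qed
qed

lemma circle_integral_FTC:
  fixes h H :: "real \<Rightarrow> real"
  assumes "\<And>x. (H has_real_derivative h x) (at x)" "\<And>x. isCont h x"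
  shows "(\<integral>x. h x \<partial>circle_measure) = H (2 * pi) - H 0"
proof -
  have m: "h \<in> borel_measurable borel"
    using assms(2) by (intro borel_measurable_continuous_onI continuous_at_imp_continuous_on) auto
  have "(\<integral>x. h x \<partial>circle_measure) = (\<integral>x. indicator {0..<2 * pi} x *\<^sub>R h x \<partial>lborel)"
    unfolding circle_measure_def by (rule integral_restrict_space) auto
  also have "\<dots> = (\<integral>x. h x * indicator {0..2 * pi} x \<partial>lborel)"
  proof (rule integral_cong_AE)
    show "AE x in lborel. indicator {0..<2 * pi} x *\<^sub>R h x = h x * indicator {0..2 * pi} x"
      using AE_lborel_singleton[of "2 * pi"] by eventually_elim (auto simp: indicator_def)
  qed (use m in measurable)
  also have "\<dots> = H (2 * pi) - H 0"
    using assms by (intro integral_FTC_Icc_real) auto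
  finally show ?thesis .
qed

section \<open>Fourier modes of the heat kernel and the heat flow\<close>

text \<open>The phase \<open>\<psi>\<close> treats sines and cosines at once; \<open>m\<close> is an
  integer so that differences of frequencies are covered.\<close>

lemma circle_integral_cos:
  "(\<integral>x. cos (of_int m * x + \<psi>) \<partial>circle_measure) = (if m = 0 then 2 * pi * cos \<psi> else 0)"
proof (cases "m = 0")
  case True
  then show ?thesis by (simp add: measure_def emeasure_circle_measure_space)
next
  case False
  have "(\<integral>x. cos (of_int m * x + \<psi>) \<partial>circle_measure)
      = sin (of_int m * (2 * pi) + \<psi>) / of_int m - sin (of_int m * 0 + \<psi>) / of_int m"
    using False by (intro circle_integral_FTC) (auto intro!: derivative_eq_intros)
  also have "sin (of_int m * (2 * pi) + \<psi>) = sin \<psi>"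
    using sin.plus_of_int[of \<psi> m] by (simp add: add.commute)
  finally show ?thesis using False by simp
qed

text \<open>Product-to-sum yields the frequencies \<open>Suc k + j\<close>, which is never zero, and
  \<open>Suc k - j\<close>, so only the resonance \<open>Suc k = j\<close> survives.\<close>

lemma integral_heat_term:
  "(\<integral>x. cos (real (Suc k) * (x - y)) * cos (real j * x + \<phi>) \<partial>circle_measure)
    = (if Suc k = j then pi * cos (real j * y + \<phi>) else 0)"
proof -
  define p q :: int where "p = int (Suc k) + int j" and "q = int (Suc k) - int j"
  have eq: "cos (real (Suc k) * (x - y)) * cos (real j * x + \<phi>) =
     (1/2) * cos (of_int p * x + (\<phi> - real (Suc k) * y)) 
     + (1/2) * cos (of_int q * x + (- real (Suc k) * y - \<phi>))" for x
    unfolding cos_times_cos p_def q_def by (simp add: algebra_simps)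
  have int: "integrable circle_measure (\<lambda>x. cos (of_int m * x + \<psi>))" for m \<psi>
    by (intro integrable_circle_continuous continuous_intros)
  have "cos (- real (Suc k) * y - \<phi>) = cos (real (Suc k) * y + \<phi>)"
    using cos_minus[of "real (Suc k) * y + \<phi>"] by (simp del: of_nat_Suc)
  moreover have "p \<noteq> 0" "q = 0 \<longleftrightarrow> Suc k = j" by (auto simp: p_def q_def)
  ultimately show ?thesis
    unfolding eq
    by (subst Bochner_Integration.integral_add)
      (auto intro!: int simp: circle_integral_cos simp del: of_nat_Suc)
qed

lemma summable_heat_coeff:
  assumes "t > 0"
  shows "summable (\<lambda>k. exp (- ((real (Suc k))\<^sup>2 * t)))"
proof (rule summable_comparison_test')
  show "summable (\<lambda>k. exp (- t) ^ k)" using assms by (intro summable_geometric) auto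
  fix k :: nat
  have "real k \<le> (real (Suc k))\<^sup>2" by (simp add: power2_eq_square algebra_simps)
  then have "real k * t \<le> (real (Suc k))\<^sup>2 * t" using assms by (intro mult_right_mono) auto
  then show "norm (exp (- ((real (Suc k))\<^sup>2 * t))) \<le> exp (- t) ^ k"
    by (simp add: exp_of_nat_mult[symmetric] mult_ac)
qed

lemma continuous_on_heat_kernel:
  assumes "t > 0"
  shows "continuous_on UNIV (heat_kernel t)"
proof -
  have "uniform_limit UNIV
     (\<lambda>N x. \<Sum>k<N. exp (- ((real (Suc k))\<^sup>2 * t)) * cos (real (Suc k) * x))
     (\<lambda>x. \<Sum>k. exp (- ((real (Suc k))\<^sup>2 * t)) * cos (real (Suc k) * x)) sequentially"
    by (intro Weierstrass_m_test[OF _ summable_heat_coeff[OF assms]]) (simp add: abs_mult mult_left_le)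
  then have "continuous_on UNIV (\<lambda>x. \<Sum>k. exp (- ((real (Suc k))\<^sup>2 * t)) * cos (real (Suc k) * x))"
    by (rule uniform_limit_theorem[rotated]) (auto intro!: continuous_intros always_eventually)
  then show ?thesis unfolding heat_kernel_def by (intro continuous_intros)
qed

lemma heat_kernel_bounded:
  assumes "t > 0"
  obtains C where "\<And>x. \<bar>heat_kernel t x\<bar> \<le> C"
proof
  fix x
  define e where "e k = exp (- ((real (Suc k))\<^sup>2 * t))" for k
  have sum: "summable e" using summable_heat_coeff[OF assms] by (simp only: e_def[abs_def])
  have le: "\<bar>e k * cos (real (Suc k) * x)\<bar> \<le> e k" for k by (simp add: e_def abs_mult mult_left_le)
  have "\<bar>\<Sum>k. e k * cos (real (Suc k) * x)\<bar> \<le> (\<Sum>k. e k)"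
    using norm_suminf_le[OF _ sum, of "\<lambda>k. e k * cos (real (Suc k) * x)"] le by simp
  then have "\<bar>1 / pi * (\<Sum>k. e k * cos (real (Suc k) * x))\<bar> \<le> 1 / pi * (\<Sum>k. e k)"
    by (simp add: abs_mult divide_right_mono)
  then show "\<bar>heat_kernel t x\<bar> \<le> 1 / (2 * pi) + 1 / pi * (\<Sum>k. e k)"
    unfolding heat_kernel_def e_def[symmetric]
    by (intro order.trans[OF abs_triangle_ineq] add_mono) auto
qed

text \<open>Waves of frequency \<open>j\<close> are eigenfunctions of convolution with the heat
  kernel. The series is integrated term by term, its terms being dominated by the summable
  \<open>e k\<close>.\<close>

lemma integral_heat_kernel_cos:
  assumes "t > 0"
  shows "(\<integral>x. heat_kernel t (x - y) * cos (real j * x + \<phi>) \<partial>circle_measure)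
    = exp (- ((real j)\<^sup>2 * t)) * cos (real j * y + \<phi>)"
proof -
  define e where "e k = exp (- ((real (Suc k))\<^sup>2 * t))" for k
  have sum: "summable e" using summable_heat_coeff[OF assms] by (simp only: e_def[abs_def])
  define g where "g k x = e k * (cos (real (Suc k) * (x - y)) * cos (real j * x + \<phi>))" for k x
  have le: "norm (g k x) \<le> e k" for k x
    by (auto simp: g_def e_def abs_mult mult_le_one)
  have sg: "summable (\<lambda>k. norm (g k x))" for x
    using le by (intro summable_comparison_test'[OF sum, of 0]) auto
  have int: "integrable circle_measure (g k)" for k
    unfolding g_def by (intro integrable_circle_continuous continuous_intros)
  have "norm (\<integral>x. norm (g k x) \<partial>circle_measure) \<le> 2 * pi * e k" for k
  proof -
    have "(\<integral>x. norm (g k x) \<partial>circle_measure) \<le> (\<integral>x. e k \<partial>circle_measure)"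
      using int le by (intro integral_mono) auto
    then show ?thesis by (simp add: measure_def emeasure_circle_measure_space)
  qed
  then have sum_int: "summable (\<lambda>k. \<integral>x. norm (g k x) \<partial>circle_measure)"
    by (intro summable_comparison_test'[OF summable_mult[OF sum, of "2 * pi"], of 0]) auto
  have g_int: "(\<integral>x. g k x \<partial>circle_measure) = (if Suc k = j then e k * pi * cos (real j * y + \<phi>) else 0)" for k
    by (simp add: g_def integral_heat_term del: of_nat_Suc)
  have sums: "(\<lambda>k. \<integral>x. g k x \<partial>circle_measure) sums (\<integral>x. (\<Sum>k. g k x) \<partial>circle_measure)"
    using int sg sum_int by (intro sums_integral) auto
  have int_sum: "integrable circle_measure (\<lambda>x. \<Sum>k. g k x)"
    using int sg sum_int by (intro integrable_suminf) auto
  have eq: "heat_kernel t (x - y) * cos (real j * x + \<phi>)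
     = 1 / (2 * pi) * cos (of_int (int j) * x + \<phi>) + 1 / pi * (\<Sum>k. g k x)" for x
  proof -
    have "summable (\<lambda>k. e k * cos (real (Suc k) * (x - y)))"
      by (intro summable_comparison_test'[OF sum, of 0]) (auto simp: e_def abs_mult mult_left_le)
    from suminf_mult2[OF this, of "cos (real j * x + \<phi>)"] show ?thesis
      by (simp add: heat_kernel_def g_def e_def algebra_simps)
  qed
  have "(\<integral>x. heat_kernel t (x - y) * cos (real j * x + \<phi>) \<partial>circle_measure)
    = 1 / (2 * pi) * (if j = 0 then 2 * pi * cos \<phi> else 0) + 1 / pi * (\<integral>x. (\<Sum>k. g k x) \<partial>circle_measure)"
    unfolding eq
    by (subst Bochner_Integration.integral_add)
      (use int_sum in \<open>auto intro!: integrable_circle_continuous continuous_intros simp: circle_integral_cos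
          simp del: of_int_of_nat_eq\<close>)
  also have "\<dots> = exp (- ((real j)\<^sup>2 * t)) * cos (real j * y + \<phi>)"
  \<comment> \<open>The series starts at frequency 1, so for \<open>j = 0\<close> only the constant
    \<open>1 / (2 * pi)\<close> contributes; for \<open>j = Suc i\<close> only the term with index
    \<open>i\<close> does.\<close>
  proof (cases j)
    case 0
    then have "(\<integral>x. (\<Sum>k. g k x) \<partial>circle_measure) = 0"
      using sums g_int by (simp add: sums_iff)
    then show ?thesis using 0 by simp
  next
    case (Suc i)
    then have "(\<lambda>k. \<integral>x. g k x \<partial>circle_measure) = (\<lambda>k. if k = i then e k * pi * cos (real j * y + \<phi>) else 0)"
      using g_int by auto
    then have "(\<integral>x. (\<Sum>k. g k x) \<partial>circle_measure) = e i * pi * cos (real j * y + \<phi>)"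
      using sums sums_single[of i "\<lambda>k. e k * pi * cos (real j * y + \<phi>)"] by (simp add: sums_iff)
    then show ?thesis using Suc by (simp add: e_def)
  qed
  finally show ?thesis .
qed

lemma borel_measurable_circle_pair:
  fixes h :: "real \<times> real \<Rightarrow> real"
  assumes "continuous_on UNIV h"
  shows "h \<in> borel_measurable (circle_measure \<Otimes>\<^sub>M circle_measure)"
proof -
  have id: "(\<lambda>x. x) \<in> borel_measurable circle_measure" by (rule borel_measurable_circle) simp
  have "(\<lambda>p. (fst p, snd p)) \<in> borel_measurable (circle_measure \<Otimes>\<^sub>M circle_measure)"
    by (intro borel_measurable_Pair measurable_compose[OF measurable_fst id]
        measurable_compose[OF measurable_snd id])
  from measurable_compose[OF this borel_measurable_continuous_onI[OF assms]] show ?thesis by simp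
qed

text \<open>Fubini moves the heat operator from \<open>f\<close> onto the cosine, where it acts as
  the factor \<open>exp (- ((real j)\<^sup>2 * t))\<close>. Measurability and boundedness serve to
  make \<open>Linf_norm\<close> of the flow meaningful.\<close>

lemma
  assumes "t > 0" "circle_continuous f"
  shows heat_flow_measurable: "heat_flow t f \<in> borel_measurable circle_measure"
    and heat_flow_bounded: "\<exists>C. \<forall>x. \<bar>heat_flow t f x\<bar> \<le> C"
    and integral_heat_flow_cos: "(\<integral>x. heat_flow t f x * cos (real j * x + \<phi>) \<partial>circle_measure)
      = exp (- ((real j)\<^sup>2 * t)) * (\<integral>y. f y * cos (real j * y + \<phi>) \<partial>circle_measure)"
proof -
  interpret pair_sigma_finite circle_measure circle_measure ..
  interpret P: finite_measure "circle_measure \<Otimes>\<^sub>M circle_measure"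
    by (intro finite_measure_pair_measure circle.finite_measure_axioms)
  have cont: "continuous_on UNIV f" using assms by (simp add: circle_continuous_def)
  have cont2: "continuous_on UNIV (\<lambda>p. heat_kernel t (fst p - snd p) * f (snd p))"
    by (intro continuous_intros continuous_on_compose2[OF continuous_on_heat_kernel[OF assms(1)]]
        continuous_on_compose2[OF cont]) auto
  obtain C where C: "\<And>x. \<bar>heat_kernel t x\<bar> \<le> C" using heat_kernel_bounded[OF assms(1)] by blast
  have fin: "integrable circle_measure f" by (rule integrable_circle_continuous[OF cont])
  have "(\<lambda>(x, y). heat_kernel t (x - y) * f y) \<in> borel_measurable (circle_measure \<Otimes>\<^sub>M circle_measure)"
    unfolding case_prod_beta' by (rule borel_measurable_circle_pair[OF cont2])
  then have "(\<lambda>x. \<integral>y. heat_kernel t (x - y) * f y \<partial>circle_measure) \<in> borel_measurable circle_measure"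
    by (rule circle.borel_measurable_lebesgue_integral)
  then show "heat_flow t f \<in> borel_measurable circle_measure"
    by (simp only: heat_flow_def[abs_def])
  have "C \<ge> 0" using C[of 0] by linarith
  have "\<bar>heat_flow t f x\<bar> \<le> (\<integral>y. C * \<bar>f y\<bar> \<partial>circle_measure)" for x
  proof -
    have "\<bar>heat_flow t f x\<bar> \<le> (\<integral>y. \<bar>heat_kernel t (x - y) * f y\<bar> \<partial>circle_measure)"
      unfolding heat_flow_def by (rule integral_abs_bound)
    also have "\<dots> \<le> (\<integral>y. C * \<bar>f y\<bar> \<partial>circle_measure)"
    proof (rule integral_mono)
      show "integrable circle_measure (\<lambda>y. \<bar>heat_kernel t (x - y) * f y\<bar>)"
        by (intro integrable_circle_continuous continuous_intros cont
              continuous_on_compose2[OF continuous_on_heat_kernel[OF assms(1)]]) auto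
    qed (use fin C in \<open>auto simp: abs_mult intro!: mult_right_mono\<close>)
    finally show ?thesis .
  qed
  then show "\<exists>C. \<forall>x. \<bar>heat_flow t f x\<bar> \<le> C" by blast
  obtain D where D: "\<forall>x\<in>{0..2 * pi}. \<bar>f x\<bar> \<le> D"
    by (rule continuous_bounded_period[OF cont])
  define F where "F = (\<lambda>(x, y). heat_kernel t (x - y) * f y * cos (real j * x + \<phi>))"
  have intF: "integrable (circle_measure \<Otimes>\<^sub>M circle_measure) F"
  proof (rule P.integrable_const_bound[of _ "C * D * 1"])
    show "F \<in> borel_measurable (circle_measure \<Otimes>\<^sub>M circle_measure)"
      unfolding F_def case_prod_beta'
      by (intro borel_measurable_circle_pair continuous_intros cont2)
    show "AE x in circle_measure \<Otimes>\<^sub>M circle_measure. norm (F x) \<le> C * D * 1"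
      using D C \<open>C \<ge> 0\<close> order.trans[OF abs_ge_zero, of "f 0" D] by (intro AE_I2) (auto simp: F_def abs_mult space_pair_measure simp del: mult_1_right intro!: mult_mono)
  qed
  have "(\<integral>x. heat_flow t f x * cos (real j * x + \<phi>) \<partial>circle_measure)
     = (\<integral>x. (\<integral>y. F (x, y) \<partial>circle_measure) \<partial>circle_measure)"
    by (simp add: heat_flow_def F_def)
  also have "\<dots> = (\<integral>y. (\<integral>x. F (x, y) \<partial>circle_measure) \<partial>circle_measure)"
    using Fubini_integral[of "\<lambda>x y. F (x, y)"] intF by simp
  also have "\<dots> = (\<integral>y. (exp (- ((real j)\<^sup>2 * t)) * (f y * cos (real j * y + \<phi>))) \<partial>circle_measure)"
  proof (rule Bochner_Integration.integral_cong)
    fix y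
    have "(\<integral>x. F (x, y) \<partial>circle_measure)
       = (\<integral>x. f y * (heat_kernel t (x - y) * cos (real j * x + \<phi>)) \<partial>circle_measure)"
      by (simp add: F_def mult_ac)
    then show "(\<integral>x. F (x, y) \<partial>circle_measure) = exp (- ((real j)\<^sup>2 * t)) * (f y * cos (real j * y + \<phi>))"
      by (simp add: integral_heat_kernel_cos[OF assms(1)])
  qed simp
  finally show "(\<integral>x. heat_flow t f x * cos (real j * x + \<phi>) \<partial>circle_measure)
      = exp (- ((real j)\<^sup>2 * t)) * (\<integral>y. f y * cos (real j * y + \<phi>) \<partial>circle_measure)"
    by simp
qed

section \<open>The essential supremum on the circle\<close>

text \<open>The bound \<open>C\<close> keeps the essential supremum below infinity, so that
  \<open>real_of_ereal\<close> does not fall back to its default value 0.\<close>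

lemma AE_le_Linf_norm:
  assumes "h \<in> borel_measurable circle_measure" "\<And>x. x \<in> {0..<2 * pi} \<Longrightarrow> \<bar>h x\<bar> \<le> C"
  shows "AE x in circle_measure. \<bar>h x\<bar> \<le> Linf_norm h" "Linf_norm h \<ge> 0"
proof -
  define S where "S = esssup circle_measure (\<lambda>x. ereal \<bar>h x\<bar>)"
  have m: "(\<lambda>x. ereal \<bar>h x\<bar>) \<in> borel_measurable circle_measure"
    using assms(1) by measurable
  have AE: "AE x in circle_measure. ereal \<bar>h x\<bar> \<le> S" unfolding S_def by (rule esssup_AE)
  have up: "S \<le> ereal C" unfolding S_def using assms(2) by (intro esssup_I m AE_I2) auto
  \<comment> \<open>The circle has positive measure, so some point satisfies the almost-everywhere
    bound; this forces \<open>S\<close> to be nonnegative and excludes minus infinity.\<close>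
  have "ae_filter circle_measure \<noteq> bot"
    by (simp add: ae_filter_eq_bot_iff emeasure_circle_measure_space ennreal_eq_0_iff not_le)
  then obtain x where "ereal \<bar>h x\<bar> \<le> S" using eventually_happens'[OF _ AE] by blast
  then have "0 \<le> S" by (metis abs_ge_zero ereal_less_eq(5) order.trans)
  with up have S: "S = ereal (Linf_norm h)" "Linf_norm h \<ge> 0"
    unfolding Linf_norm_def S_def[symmetric] by (cases S; auto)+
  then show "AE x in circle_measure. \<bar>h x\<bar> \<le> Linf_norm h" "Linf_norm h \<ge> 0" using AE by auto
qed

section \<open>Pairing with a product of sines\<close>

lemma continuous_on_sin_prod [continuous_intros]: "continuous_on A (sin_prod zs)"
proof -
  have "continuous_on A (\<lambda>x. sin_prod zs x)"
  proof (induction zs)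
    case (Cons z zs)
    have "sin_prod (z # zs) = (\<lambda>x. sin ((z - x) / 2) * sin_prod zs x)"
      by (auto simp: sin_prod_def)
    then show ?case using Cons by (auto intro!: continuous_intros)
  qed (simp add: sin_prod_def)
  then show ?thesis by simp
qed

text \<open>Each sine factor splits \<open>cos (j x / 2 + \<phi>)\<close> into the average of two waves of half-frequency \<open>j \<plusminus> 1\<close>,
  so a bound for all low frequencies survives multiplication by \<open>sin_prod zs\<close> without any loss.\<close>

lemma integral_sin_prod_bound:
  assumes f: "continuous_on UNIV f"
    and bound: "\<And>j \<phi>. j \<le> N \<Longrightarrow> \<bar>\<integral>x. f x * cos (real j * x + \<phi>) \<partial>circle_measure\<bar> \<le> B"
    and j: "int (length zs) + \<bar>j\<bar> \<le> 2 * int N" "even (int (length zs) + j)"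
  shows "\<bar>\<integral>x. f x * cos (of_int j * x / 2 + \<phi>) * sin_prod zs x \<partial>circle_measure\<bar> \<le> B"
  using j
proof (induction zs arbitrary: j \<phi>)
  case Nil
  \<comment> \<open>With no factors left, parity makes \<open>j / 2\<close> an integer frequency; a
    negative one is reflected by evenness of the cosine.\<close>
  then obtain i where i: "j = 2 * i" by auto
  show ?case
  proof (cases "i \<ge> 0")
    case True
    then have "of_int j / 2 = real (nat i)" by (simp add: i)
    then have "cos (of_int j * x / 2 + \<phi>) = cos (real (nat i) * x + \<phi>)" for x
      by (metis times_divide_eq_left)
    then show ?thesis using bound[of "nat i" \<phi>] Nil i True by (simp add: sin_prod_def)
  next
    case False
    then have "of_int j / 2 = - real (nat (-i))" by (simp add: i)
    then have "cos (of_int j * x / 2 + \<phi>) = cos (- (real (nat (-i)) * x + - \<phi>))" for x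
      by (metis minus_add_distrib minus_minus mult_minus_left times_divide_eq_left)
    then have "cos (of_int j * x / 2 + \<phi>) = cos (real (nat (-i)) * x + - \<phi>)" for x
      by (metis cos_minus)
    then show ?thesis using bound[of "nat (-i)" "- \<phi>"] Nil i False by (simp add: sin_prod_def)
  qed
next
  case (Cons z zs)
  define I where "I l \<psi> = (\<integral>x. f x * cos (of_int l * x / 2 + \<psi>) * sin_prod zs x \<partial>circle_measure)"
    for l \<psi>
  \<comment> \<open>The shifts by \<open>pi / 2\<close> rewrite as cosines the two sines in the
    product-to-sum formula for \<open>cos u * sin w\<close>.\<close>
  define \<alpha> \<beta> where "\<alpha> = \<phi> + z / 2 - pi / 2" and "\<beta> = z / 2 - \<phi> - pi / 2"
  have trig: "cos (of_int j * x / 2 + \<phi>) * sin ((z - x) / 2)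
     = (cos (of_int (j - 1) * x / 2 + \<alpha>) + cos (of_int (- j - 1) * x / 2 + \<beta>)) / 2" for x
  proof -
    define u w where "u = of_int j * x / 2 + \<phi>" and "w = (z - x) / 2"
    have "of_int (j - 1) * x / 2 + \<alpha> = - (pi / 2 - (u + w))"
      "of_int (- j - 1) * x / 2 + \<beta> = - (pi / 2 - (w - u))"
      by (simp_all add: \<alpha>_def \<beta>_def u_def w_def field_simps)
    moreover have c: "cos (- (pi / 2 - v)) = sin v" for v
      unfolding cos_minus by (simp add: cos_diff)
    ultimately have "cos (of_int (j - 1) * x / 2 + \<alpha>) = sin (u + w)"
      "cos (of_int (- j - 1) * x / 2 + \<beta>) = - sin (u - w)"
      using c[of "u + w"] c[of "w - u"] sin_minus[of "u - w"] by simp_all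
    then show ?thesis by (simp add: u_def w_def cos_times_sin)
  qed
  have eq: "f x * cos (of_int j * x / 2 + \<phi>) * sin_prod (z # zs) x
     = (1/2) * (f x * cos (of_int (j - 1) * x / 2 + \<alpha>) * sin_prod zs x)
     + (1/2) * (f x * cos (of_int (- j - 1) * x / 2 + \<beta>) * sin_prod zs x)" for x
  proof -
    have "f x * cos (of_int j * x / 2 + \<phi>) * sin_prod (z # zs) x
      = f x * (cos (of_int j * x / 2 + \<phi>) * sin ((z - x) / 2)) * sin_prod zs x"
      by (simp add: sin_prod_def)
    then show ?thesis unfolding trig by (simp add: algebra_simps)
  qed
  have int: "integrable circle_measure (\<lambda>x. f x * cos (of_int l * x / 2 + \<psi>) * sin_prod zs x)" for l \<psi>
    by (intro integrable_circle_continuous continuous_intros f) auto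
  have "(\<integral>x. f x * cos (of_int j * x / 2 + \<phi>) * sin_prod (z # zs) x \<partial>circle_measure)
     = (1/2) * I (j - 1) \<alpha> + (1/2) * I (- j - 1) \<beta>"
    unfolding eq I_def
    by (subst Bochner_Integration.integral_add[OF integrable_mult_right[OF int] integrable_mult_right[OF int]])
      (simp only: integral_mult_right_zero)
  \<comment> \<open>Removing a factor lowers the length by one and raises the absolute
    half-frequency by at most one, so the degree budget and the parity are preserved.\<close>
  moreover have "\<bar>I (j - 1) \<alpha>\<bar> \<le> B" "\<bar>I (- j - 1) \<beta>\<bar> \<le> B"
    unfolding I_def using Cons.prems by (intro Cons.IH; auto)+
  ultimately show ?case by linarith
qed

section \<open>Lower bounds for products of sines\<close>

text \<open>Jordan's inequality: by concavity the sine lies above its chord from 0 to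
  \<open>pi / 2\<close>.\<close>

lemma sin_ge_linear:
  assumes "0 \<le> u" "u \<le> pi"
  shows "sin (u / 2) \<ge> u / pi"
proof -
  have "convex_on {0..pi / 2} (\<lambda>x. - sin x)"
  proof (rule f''_ge0_imp_convex)
    show "((\<lambda>x. - sin x) has_real_derivative - cos x) (at x)" for x :: real
      by (auto intro!: derivative_eq_intros)
    show "((\<lambda>x. - cos x) has_real_derivative sin x) (at x)" for x :: real
      by (auto intro!: derivative_eq_intros)
    show "sin x \<ge> 0" if "x \<in> {0..pi / 2}" for x
      using that by (intro sin_ge_zero) auto
  qed simp
  then have "- sin ((1 - u / pi) *\<^sub>R 0 + (u / pi) *\<^sub>R (pi / 2))
      \<le> (1 - u / pi) * - sin 0 + u / pi * - sin (pi / 2)"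
    using assms by (intro convex_onD_Icc) auto
  then show ?thesis by simp
qed

lemma abs_sin_ge_linear:
  assumes "\<bar>u\<bar> \<le> pi"
  shows "\<bar>sin (u / 2)\<bar> \<ge> \<bar>u\<bar> / pi"
proof -
  have "\<bar>sin (u / 2)\<bar> = \<bar>sin (\<bar>u\<bar> / 2)\<bar>" by (cases "u \<ge> 0") auto
  then show ?thesis using sin_ge_linear[of "\<bar>u\<bar>"] assms by auto
qed

text \<open>The sine is small only near \<open>z\<close> modulo \<open>2 * pi\<close>. Once
  \<open>z\<close> is reduced to one period, three translates of an interval of length
  \<open>2 * \<delta>\<close> cover every such \<open>x\<close>.\<close>

lemma measure_sin_small:
  assumes "\<delta> > 0"
  shows "measure circle_measure {x \<in> {0..<2 * pi}. \<bar>sin ((z - x) / 2)\<bar> < \<delta> / pi} \<le> 6 * \<delta>" (is "measure _ (?A z) \<le> _")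
proof -
  have shift: "\<bar>sin ((z + 2 * pi - x) / 2)\<bar> = \<bar>sin ((z - x) / 2)\<bar>" for x z :: real
    using sin_periodic_pi[of "(z - x) / 2"] by (simp add: add_divide_distrib diff_divide_distrib algebra_simps)
  obtain w where w: "w \<in> {0..<0 + 2 * pi}" "?A w = ?A z"
    by (rule periodic_reduce[of ?A 0 z]) (simp only: shift, blast)
  define J where "J c = {w + c - \<delta>..w + c + \<delta>}" for c
  have near: "\<bar>u\<bar> \<le> \<delta>" if "\<bar>sin (u / 2)\<bar> < \<delta> / pi" "\<bar>u\<bar> \<le> pi" for u
    using that abs_sin_ge_linear[of u] by (simp add: field_simps)
  have "?A w \<subseteq> J 0 \<union> J (2 * pi) \<union> J (- 2 * pi)"
  proof safe
    fix x assume x: "x \<in> {0..<2 * pi}" "\<bar>sin ((w - x) / 2)\<bar> < \<delta> / pi" "x \<notin> J (- 2 * pi)" "x \<notin> J (2 * pi)"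
    have "\<bar>sin ((w - 2 * pi - x) / 2)\<bar> < \<delta> / pi" "\<bar>sin ((w + 2 * pi - x) / 2)\<bar> < \<delta> / pi"
      using x(2) shift[of w x] shift[of "w - 2 * pi" x] by auto
    note n = near[OF x(2)] near[OF this(1)] near[OF this(2)]
    \<comment> \<open>Outside the two outer intervals, both shifted distances must exceed
      \<open>pi\<close>, which leaves \<open>w\<close> itself within \<open>pi\<close> of
      \<open>x\<close>.\<close>
    have "\<not> \<bar>w - 2 * pi - x\<bar> \<le> \<delta>" "\<not> \<bar>w + 2 * pi - x\<bar> \<le> \<delta>"
      using x(3,4) by (auto simp: J_def abs_le_iff)
    then have "\<not> \<bar>w - 2 * pi - x\<bar> \<le> pi" "\<not> \<bar>w + 2 * pi - x\<bar> \<le> pi"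
      using n(2,3) by blast+
    then have "\<bar>w - x\<bar> \<le> pi" using x(1) w(1) by simp
    then show "x \<in> J 0" using n(1) by (simp add: J_def abs_le_iff)
  qed
  moreover have "?A w \<in> sets borel"
  proof -
    have "(\<lambda>x. \<bar>sin ((w - x) / 2)\<bar>) \<in> borel_measurable borel"
      by (intro borel_measurable_continuous_onI continuous_intros) auto
    then show ?thesis by measurable
  qed
  moreover have J: "J c \<in> fmeasurable lborel" for c
    unfolding J_def by (metis cbox_interval fmeasurable_cbox)
  ultimately have "measure circle_measure (?A w) \<le> measure lborel (J 0 \<union> J (2 * pi) \<union> J (- 2 * pi))"
    by (intro measure_circle_le fmeasurable.Un) auto
  also have "\<dots> \<le> measure lborel (J 0) + measure lborel (J (2 * pi)) + measure lborel (J (- 2 * pi))"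
    using measure_Un_le[of "J 0 \<union> J (2 * pi)" lborel "J (- 2 * pi)"]
      measure_Un_le[of "J 0" lborel "J (2 * pi)"] by (simp add: J_def)
  also have "\<dots> = 6 * \<delta>" using assms by (simp add: J_def)
  finally show ?thesis using w(2) by simp
qed

lemma abs_sin_prod_ge:
  assumes "0 \<le> \<eta>" "\<And>z. z \<in> set zs \<Longrightarrow> \<eta> \<le> \<bar>sin ((z - x) / 2)\<bar>"
  shows "\<eta> ^ length zs \<le> \<bar>sin_prod zs x\<bar>"
  using assms(2)
proof (induction zs)
  case (Cons z zs)
  then have "\<eta> * \<eta> ^ length zs \<le> \<bar>sin ((z - x) / 2)\<bar> * \<bar>sin_prod zs x\<bar>"
    using assms(1) by (intro mult_mono) auto
  then show ?case by (simp add: sin_prod_def abs_mult)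
qed (simp add: sin_prod_def)

text \<open>Let \<open>U\<close> be the set where some factor is below \<open>\<delta> / pi\<close>.
  Off \<open>U\<close> the product is at least the stated power; on \<open>U\<close> the mass of
  \<open>\<bar>f\<bar>\<close> is at most \<open>L\<close> times the measure of
  \<open>U\<close>.\<close>

lemma integral_abs_sin_prod_ge:
  assumes f: "continuous_on UNIV f" and L: "AE x in circle_measure. \<bar>f x\<bar> \<le> L" "L \<ge> 0"
    and \<delta>: "0 < \<delta>" "\<delta> \<le> pi" and n: "length zs \<le> n"
  shows "(\<delta> / pi) ^ n * (L1_norm f - L * (real n * (6 * \<delta>)))
     \<le> (\<integral>x. \<bar>f x * sin_prod zs x\<bar> \<partial>circle_measure)"
proof -
  define \<eta> where "\<eta> = \<delta> / pi"
  have \<eta>: "0 \<le> \<eta>" "\<eta> \<le> 1" using \<delta> by (auto simp: \<eta>_def)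
  define A where "A z = {x \<in> {0..<2 * pi}. \<bar>sin ((z - x) / 2)\<bar> < \<eta>}" for z
  define U where "U = (\<Union>z\<in>set zs. A z)"
  have A: "A z \<in> sets circle_measure" for z
  proof -
    have "A z = {x \<in> space circle_measure. \<bar>sin ((z - x) / 2)\<bar> < \<eta>}" by (simp add: A_def)
    also have "(\<lambda>x. \<bar>sin ((z - x) / 2)\<bar>) \<in> borel_measurable circle_measure"
      by (intro borel_measurable_circle borel_measurable_continuous_onI continuous_intros) auto
    then have "{x \<in> space circle_measure. \<bar>sin ((z - x) / 2)\<bar> < \<eta>} \<in> sets circle_measure"
      by measurable
    finally show ?thesis .
  qed
  then have U: "U \<in> sets circle_measure" by (auto simp: U_def)
  have "measure circle_measure U \<le> (\<Sum>z\<in>set zs. measure circle_measure (A z))"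
    unfolding U_def using A by (intro circle.finite_measure_subadditive_finite) auto
  also have "\<dots> \<le> (\<Sum>z\<in>set zs. 6 * \<delta>)"
    unfolding A_def \<eta>_def by (intro sum_mono measure_sin_small \<delta>)
  also have "\<dots> = real (card (set zs)) * (6 * \<delta>)" by simp
  also have "\<dots> \<le> real n * (6 * \<delta>)"
    using \<delta> n card_length[of zs] by (intro mult_right_mono) auto
  finally have mU: "measure circle_measure U \<le> real n * (6 * \<delta>)" .
  have intU: "integrable circle_measure (indicator U :: real \<Rightarrow> real)"
    using U by (simp add: circle.emeasure_finite less_top[symmetric])
  have int: "integrable circle_measure (\<lambda>x. \<bar>f x\<bar>)"
    by (intro integrable_circle_continuous continuous_intros f)
  have "\<eta> ^ n * (L1_norm f - L * (real n * (6 * \<delta>))) \<le> \<eta> ^ n * (L1_norm f - L * measure circle_measure U)"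
    using mU L \<eta> by (intro mult_left_mono diff_mono order.refl) auto
  also have "\<dots> = (\<integral>x. \<eta> ^ n * (\<bar>f x\<bar> - L * indicator U x) \<partial>circle_measure)"
    using int intU sets.sets_into_space[OF U] by (simp add: L1_norm_def Int_absorb2)
  also have "\<dots> \<le> (\<integral>x. \<bar>f x * sin_prod zs x\<bar> \<partial>circle_measure)"
  proof (rule integral_mono_AE)
    show "AE x in circle_measure. \<eta> ^ n * (\<bar>f x\<bar> - L * indicator U x) \<le> \<bar>f x * sin_prod zs x\<bar>"
      using L(1)
    proof (rule AE_mp, intro AE_I2 impI)
      fix x assume x: "x \<in> space circle_measure" "\<bar>f x\<bar> \<le> L"
      show "\<eta> ^ n * (\<bar>f x\<bar> - L * indicator U x) \<le> \<bar>f x * sin_prod zs x\<bar>"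
      proof (cases "x \<in> U")
        case True
        \<comment> \<open>Subtracting \<open>L\<close> on \<open>U\<close> makes the minorant
          nonpositive there, so no lower bound for the product is required.\<close>
        then have "\<eta> ^ n * (\<bar>f x\<bar> - L * indicator U x) \<le> 0"
          using x \<eta> by (simp add: mult_nonneg_nonpos)
        then show ?thesis by linarith
      next
        case False
        then have "\<eta> ^ length zs \<le> \<bar>sin_prod zs x\<bar>"
          using x \<eta> by (intro abs_sin_prod_ge) (auto simp: U_def A_def)
        \<comment> \<open>The condition \<open>\<eta> \<le> 1\<close>, that is
          \<open>\<delta> \<le> pi\<close>, allows the exponent to grow from
          \<open>length zs\<close> to \<open>n\<close>.\<close>
        then have "\<eta> ^ n \<le> \<bar>sin_prod zs x\<bar>"
          using power_decreasing[OF n \<eta>] by linarith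
        then show ?thesis using False by (simp add: abs_mult mult.commute mult_left_mono)
      qed
    qed
    show "integrable circle_measure (\<lambda>x. \<eta> ^ n * (\<bar>f x\<bar> - L * indicator U x))"
      using int intU by auto
    show "integrable circle_measure (\<lambda>x. \<bar>f x * sin_prod zs x\<bar>)"
      by (intro integrable_circle_continuous continuous_intros f)
  qed
  finally show ?thesis by (simp add: \<eta>_def)
qed

section \<open>Norm estimates for the datum and its heat flow\<close>

text \<open>Ensures later that the threshold \<open>\<delta>\<close>, a multiple of the ratio of the
  two norms, is at most \<open>pi\<close>.\<close>

lemma L1_norm_le_Linf:
  assumes "AE x in circle_measure. \<bar>f x\<bar> \<le> L" "continuous_on UNIV f"
  shows "L1_norm f \<le> 2 * pi * L"
proof -
  have "L1_norm f \<le> (\<integral>x. L \<partial>circle_measure)"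
    unfolding L1_norm_def using assms
    by (intro integral_mono_AE integrable_circle_continuous continuous_intros) auto
  then show ?thesis by (simp add: measure_def emeasure_circle_measure_space)
qed

text \<open>Undoing the damping of a frequency \<open>j \<le> n\<close> costs at most
  \<open>exp ((real n)\<^sup>2 * t)\<close>; the factor \<open>2 * pi\<close> is the length of the
  circle.\<close>

lemma heat_flow_low_frequency_bound:
  assumes "t > 0" "circle_continuous f" "j \<le> n"
  shows "\<bar>\<integral>x. f x * cos (real j * x + \<phi>) \<partial>circle_measure\<bar>
     \<le> exp ((real n)\<^sup>2 * t) * (2 * pi * Linf_norm (heat_flow t f))"
proof -
  define H where "H = Linf_norm (heat_flow t f)"
  obtain C where C: "\<And>x. \<bar>heat_flow t f x\<bar> \<le> C" using heat_flow_bounded[OF assms(1,2)] by blast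
  have [measurable]: "heat_flow t f \<in> borel_measurable circle_measure"
    by (rule heat_flow_measurable[OF assms(1,2)])
  have H: "AE x in circle_measure. \<bar>heat_flow t f x\<bar> \<le> H" "H \<ge> 0"
    unfolding H_def using AE_le_Linf_norm[of "heat_flow t f" C] C by auto
  have [measurable]: "(\<lambda>x. cos (real j * x + \<phi>)) \<in> borel_measurable circle_measure"
    by (intro borel_measurable_circle borel_measurable_continuous_onI continuous_intros)
  have bd: "AE x in circle_measure. \<bar>heat_flow t f x * cos (real j * x + \<phi>)\<bar> \<le> H"
    using H(1)
  proof eventually_elim
    case (elim x)
    have "\<bar>heat_flow t f x\<bar> * \<bar>cos (real j * x + \<phi>)\<bar> \<le> H * 1"
      using elim H(2) by (intro mult_mono) auto
    then show ?case by (simp add: abs_mult)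
  qed
  have int: "integrable circle_measure (\<lambda>x. heat_flow t f x * cos (real j * x + \<phi>))"
    using bd by (intro circle.integrable_const_bound[of _ H]) auto
  have "\<bar>\<integral>x. heat_flow t f x * cos (real j * x + \<phi>) \<partial>circle_measure\<bar>
     \<le> (\<integral>x. \<bar>heat_flow t f x * cos (real j * x + \<phi>)\<bar> \<partial>circle_measure)"
    by (rule integral_abs_bound)
  also have "\<dots> \<le> (\<integral>x. H \<partial>circle_measure)"
    using bd int by (intro integral_mono_AE integrable_abs) auto
  also have "\<dots> = 2 * pi * H" by (simp add: measure_def emeasure_circle_measure_space)
  finally have le: "exp (- ((real j)\<^sup>2 * t)) * \<bar>\<integral>x. f x * cos (real j * x + \<phi>) \<partial>circle_measure\<bar> \<le> 2 * pi * H"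
    by (simp add: integral_heat_flow_cos[OF assms(1,2)] abs_mult)
  have "\<bar>\<integral>x. f x * cos (real j * x + \<phi>) \<partial>circle_measure\<bar> = exp ((real j)\<^sup>2 * t) *
     (exp (- ((real j)\<^sup>2 * t)) * \<bar>\<integral>x. f x * cos (real j * x + \<phi>) \<partial>circle_measure\<bar>)"
    by (simp add: exp_minus)
  also have "\<dots> \<le> exp ((real n)\<^sup>2 * t) * (2 * pi * H)"
    using assms by (intro mult_mono le) (auto intro!: mult_right_mono power_mono)
  finally show ?thesis by (simp add: H_def)
qed

theorem corollary4:
  fixes n :: nat and t :: real
  assumes "t > 0"
  shows "\<exists>c::real. c > 0 \<and>
    (\<forall>f :: real \<Rightarrow> real.
       circle_continuous f \<longrightarrow> (\<exists>x. f x \<noteq> 0) \<longrightarrow> changes_sign_times f n \<longrightarrow>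
       Linf_norm (heat_flow t f) \<ge> c * (L1_norm f ^ (n + 1) / Linf_norm f ^ n))"
proof (intro exI conjI allI impI)
  \<comment> \<open>With \<open>\<delta> = L1 / (a * L)\<close> the loss
    \<open>L * (real n * (6 * \<delta>))\<close> is \<open>n / (n + 1)\<close> times
    \<open>L1 / 2\<close>; the summand 1 keeps \<open>a\<close> positive for \<open>n = 0\<close>.
    Then \<open>c\<close> is read off from
    \<open>(\<delta> / pi) ^ n * (L1 / 2) / E\<close>.\<close>
  define a where "a = 12 * (real n + 1)"
  define E where "E = exp ((real n)\<^sup>2 * t) * (2 * pi)"
  define c where "c = (1 / (a * pi)) ^ n / (2 * E)"
  have pos: "a > 0" "E > 0" by (auto simp: a_def E_def)
  then show "c > 0" by (simp add: c_def)
  fix f :: "real \<Rightarrow> real"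
  assume f: "circle_continuous f" "\<exists>x. f x \<noteq> 0" and n: "changes_sign_times f n"
  define L L1 H where "L = Linf_norm f" and "L1 = L1_norm f" and "H = Linf_norm (heat_flow t f)"
  have cont: "continuous_on UNIV f" using f by (simp add: circle_continuous_def)
  obtain D where "\<forall>x\<in>{0..2 * pi}. \<bar>f x\<bar> \<le> D"
    by (rule continuous_bounded_period[OF cont])
  then have L: "AE x in circle_measure. \<bar>f x\<bar> \<le> L" "L \<ge> 0"
    using AE_le_Linf_norm[of f D, OF borel_measurable_circle[OF borel_measurable_continuous_onI[OF cont]]]
    by (auto simp: L_def)
  have L1: "L1 \<le> 2 * pi * L" unfolding L1_def by (rule L1_norm_le_Linf[OF L(1) cont])
  have "L1 \<ge> 0" by (simp add: L1_def L1_norm_def)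
  obtain C where C: "\<And>x. \<bar>heat_flow t f x\<bar> \<le> C" using heat_flow_bounded[OF assms f(1)] by blast
  have H0: "H \<ge> 0"
    unfolding H_def using AE_le_Linf_norm[OF heat_flow_measurable[OF assms f(1)]] C by blast
  have "c * (L1 ^ (n + 1) / L ^ n) \<le> H"
  \<comment> \<open>If \<open>L1 = 0\<close>, the left side is 0 because the exponent
    \<open>n + 1\<close> is positive. Otherwise \<open>L1 \<le> 2 * pi * L\<close> gives
    \<open>L > 0\<close>, so the quotients are genuine.\<close>
  proof (cases "L1 = 0")
    case False
    with \<open>L1 \<ge> 0\<close> L1 L(2) have L0: "L1 > 0" "L > 0" by (auto simp: less_le)
    obtain s zs where s: "\<bar>s\<bar> = 1" and zs: "even (length zs)" "length zs \<le> n"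
      and sgn: "\<And>x. s * f x * sin_prod zs x \<ge> 0"
      using sign_changes_sin_prod[OF f n] by blast
    define \<delta> where "\<delta> = L1 / (a * L)"
    have "2 * (pi * L) \<le> a * (pi * L)" using L0 by (intro mult_right_mono) (auto simp: a_def)
    then have "L1 \<le> pi * (a * L)" using L1 by (simp add: mult_ac)
    then have \<delta>: "0 < \<delta>" "\<delta> \<le> pi" using L0 pos by (auto simp: \<delta>_def field_simps)
    have "L * (real n * (6 * \<delta>)) = real n * 6 * (L1 / a)"
      using L0 by (simp add: \<delta>_def)
    also have "\<dots> = L1 * (real n / (real n + 1)) / 2"
      unfolding a_def by (simp add: divide_simps)
    also have "\<dots> \<le> L1 / 2" using L0 by (intro divide_right_mono mult_left_le) auto
    finally have half: "L1 / 2 \<le> L1 - L * (real n * (6 * \<delta>))" by simp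
    have "(\<delta> / pi) ^ n * (L1 / 2) \<le> (\<delta> / pi) ^ n * (L1 - L * (real n * (6 * \<delta>)))"
      using half \<delta> by (intro mult_left_mono) auto
    also have "\<dots> \<le> (\<integral>x. \<bar>f x * sin_prod zs x\<bar> \<partial>circle_measure)"
      unfolding L1_def by (rule integral_abs_sin_prod_ge[OF cont L \<delta> zs(2)])
    \<comment> \<open>The sign pattern turns the absolute value into the factor \<open>s\<close>.
      The cosine of frequency 0 equals 1 and brings the integrand into the form of
      \<open>integral_sin_prod_bound\<close>.\<close>
    also have "\<dots> = (\<integral>x. s * (f x * cos (of_int 0 * x / 2 + 0) * sin_prod zs x) \<partial>circle_measure)"
    proof (rule Bochner_Integration.integral_cong)
      fix x
      have "\<bar>f x * sin_prod zs x\<bar> = \<bar>s * f x * sin_prod zs x\<bar>" using s by (simp add: abs_mult)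
      then show "\<bar>f x * sin_prod zs x\<bar> = s * (f x * cos (of_int 0 * x / 2 + 0) * sin_prod zs x)"
        using sgn[of x] by simp
    qed simp
    also have "\<dots> \<le> \<bar>\<integral>x. f x * cos (of_int 0 * x / 2 + 0) * sin_prod zs x \<partial>circle_measure\<bar>"
      by (rule order.trans[OF abs_ge_self]) (use s in \<open>simp add: abs_mult\<close>)
    \<comment> \<open>The product has degree \<open>length zs / 2 \<le> n\<close>, so only
      frequencies up to \<open>n\<close> enter.\<close>
    also have "\<dots> \<le> E * H"
      unfolding E_def H_def using zs
      by (intro integral_sin_prod_bound[OF cont, of n])
        (use heat_flow_low_frequency_bound[OF assms f(1)] in \<open>auto simp: mult.assoc\<close>)
    finally have "(\<delta> / pi) ^ n * (L1 / 2) / E \<le> H" using pos by (simp add: field_simps)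
    moreover have "(\<delta> / pi) ^ n * (L1 / 2) / E = c * (L1 ^ (n + 1) / L ^ n)"
      by (simp add: c_def \<delta>_def power_divide power_mult_distrib field_simps)
    ultimately show ?thesis by simp
  qed (use H0 in simp)
  then show "Linf_norm (heat_flow t f) \<ge> c * (L1_norm f ^ (n + 1) / Linf_norm f ^ n)"
    by (simp add: H_def L1_def L_def)
qed

end
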